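(* Let $\Gamma=(G,v_0,\mathcal{L})$ be a terminal game such that: (TWO) there are exactly two players, $n=|I|=2$; (SYM) $G$ is symmetric; (CIW) infinite plays are worse than any terminal play for all players, i.e. $\mathcal{L}^i(w)<0$ for all $i\in I$ and $w\in V_T$. Then $\Gamma$ has a uniform Nash equilibrium (in pure stationary strategies).
   Context: **Terminal games.** $G=(V,E)$ is a finite directed graph (loops allowed); vertices are positions, directed edges are moves. $I=\{1,\dots,n\}$ is the set of players. $V=V_1\cup\dots\cup V_n\cup V_T$ is a given partition of $V$, where $V_i$ is the set of positions controlled by player $i$ and $V_T\ne\emptyset$ is the set of terminal positions; terminals are exactly the positions with no outgoing edge. $v_0\in V\setminus V_T$ is the initial position. $\mathcal{L}=(\mathcal{L}^i\mid i\in I)$ with $\mathcal{L}^i:V_T\to\mathbb{R}$. A (pure stationary) strategy of player $i$ is a map $\sigma_i:V_i\to V$ with $(v,\sigma_i(v))\in E$ for all $v\in V_i$. A situation is a tuple $\sigma=(\sigma_i\mid i\in I)$ of strategies. The play $P(\sigma)$ is the directed walk starting at $v_0$ that from each position $v\in V_i$ moves to $\sigma_i(v)$; it either reaches a terminal and stops, or is infinite. The effective cost $\mathcal{L}^i(\sigma)$ of player $i$ is $\mathcal{L}^i(w)$ if $P(\sigma)$ terminates at $w\in V_T$, and $0$ if $P(\sigma)$ is infinite. All players minimize their effective cost. A situation $\sigma$ is a Nash equilibrium (NE) if $\mathcal{L}^i(\sigma)\le\mathcal{L}^i(\sigma')$ for every player $i$ and every situation $\sigma'$ that may differ from $\sigma$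 only in the strategy of player $i$. A situation is a uniform Nash equilibrium (UNE) if it is a NE no matter what the initial position is, i.e. the same $\sigma$ is a NE of $(G,v,\mathcal{L})$ for every choice of initial position $v$. $G$ is symmetric if $(u,v)\in E$ whenever $(v,u)\in E$, except if $u\in V_T$. *)

theory Defs
  imports Complex_Main "HOL-Library.FuncSet" "HOL-Library.Disjoint_Sets"
begin

text \<open>The players are \<open>1, \<dots>, num_players \<Gamma>\<close>. The values of \<open>control\<close> outside this range and
  of \<open>cost\<close> outside players and terminals are never used.\<close>

record 'v terminal_game =
  positions :: "'v set"
  moves :: "('v \<times> 'v) set"
  num_players :: nat
  control :: "nat \<Rightarrow> 'v set"
  terminals :: "'v set"
  initial :: 'v
  cost :: "nat \<Rightarrow> 'v \<Rightarrow> real"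

definition players :: "'v terminal_game \<Rightarrow> nat set" where
  "players \<Gamma> = {1..num_players \<Gamma>}"

text \<open>A player is allowed to control no position at all.\<close>

definition is_terminal_game :: "'v terminal_game \<Rightarrow> bool" where
  "is_terminal_game \<Gamma> \<longleftrightarrow>
     finite (positions \<Gamma>) \<and>
     moves \<Gamma> \<subseteq> positions \<Gamma> \<times> positions \<Gamma> \<and>
     positions \<Gamma> = (\<Union>i\<in>players \<Gamma>. control \<Gamma> i) \<union> terminals \<Gamma> \<and>
     disjoint_family_on (control \<Gamma>) (players \<Gamma>) \<and>
     (\<forall>i\<in>players \<Gamma>. control \<Gamma> i \<inter> terminals \<Gamma> = {}) \<and>
     terminals \<Gamma> \<noteq> {} \<and>
     (\<forall>v\<in>positions \<Gamma>. v \<in> terminals \<Gamma> \<longleftrightarrow> moves \<Gamma> `` {v} = {}) \<and>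
     initial \<Gamma> \<in> positions \<Gamma> - terminals \<Gamma>"

definition strategies :: "'v terminal_game \<Rightarrow> nat \<Rightarrow> ('v \<Rightarrow> 'v) set" where
  "strategies \<Gamma> i = (\<Pi>\<^sub>E v\<in>control \<Gamma> i. moves \<Gamma> `` {v})"

definition situations :: "'v terminal_game \<Rightarrow> (nat \<Rightarrow> 'v \<Rightarrow> 'v) set" where
  "situations \<Gamma> = (\<Pi>\<^sub>E i\<in>players \<Gamma>. strategies \<Gamma> i)"

definition owner :: "'v terminal_game \<Rightarrow> 'v \<Rightarrow> nat" where
  "owner \<Gamma> v = (THE i. i \<in> players \<Gamma> \<and> v \<in> control \<Gamma> i)"

text \<open>\<open>play \<Gamma> \<sigma> k\<close> is the position after \<open>k\<close> moves, or \<open>None\<close> if the play has stopped before.\<close>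

primrec play :: "'v terminal_game \<Rightarrow> (nat \<Rightarrow> 'v \<Rightarrow> 'v) \<Rightarrow> nat \<Rightarrow> 'v option" where
  "play \<Gamma> \<sigma> 0 = Some (initial \<Gamma>)"
| "play \<Gamma> \<sigma> (Suc k) =
     (case play \<Gamma> \<sigma> k of
        None \<Rightarrow> None
      | Some v \<Rightarrow> if v \<in> terminals \<Gamma> then None else Some (\<sigma> (owner \<Gamma> v) v))"

definition terminates_at :: "'v terminal_game \<Rightarrow> (nat \<Rightarrow> 'v \<Rightarrow> 'v) \<Rightarrow> 'v \<Rightarrow> bool" where
  "terminates_at \<Gamma> \<sigma> w \<longleftrightarrow> w \<in> terminals \<Gamma> \<and> (\<exists>k. play \<Gamma> \<sigma> k = Some w)"

lemma play_None_mono: "play \<Gamma> \<sigma> k = None \<Longrightarrow> k \<le> l \<Longrightarrow> play \<Gamma> \<sigma> l = None"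
  by (induction l) (auto simp: le_Suc_eq)

lemma terminates_at_unique:
  assumes "terminates_at \<Gamma> \<sigma> w" "terminates_at \<Gamma> \<sigma> w'"
  shows "w = w'"
proof -
  obtain k l where kl: "play \<Gamma> \<sigma> k = Some w" "play \<Gamma> \<sigma> l = Some w'"
    using assms by (auto simp: terminates_at_def)
  have "play \<Gamma> \<sigma> (Suc k) = None" "play \<Gamma> \<sigma> (Suc l) = None"
    using assms kl by (auto simp: terminates_at_def)
  then have "\<not> Suc k \<le> l" "\<not> Suc l \<le> k"
    using kl play_None_mono by fastforce+
  then have "k = l" by simp
  then show ?thesis using kl by simp
qed

lemma infinite_play_iff: "(\<forall>k. play \<Gamma> \<sigma> k \<noteq> None) \<longleftrightarrow> (\<nexists>w. terminates_at \<Gamma> \<sigma> w)"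
proof
  assume inf: "\<forall>k. play \<Gamma> \<sigma> k \<noteq> None"
  show "\<nexists>w. terminates_at \<Gamma> \<sigma> w"
  proof
    assume "\<exists>w. terminates_at \<Gamma> \<sigma> w"
    then obtain w k where "w \<in> terminals \<Gamma>" "play \<Gamma> \<sigma> k = Some w"
      by (auto simp: terminates_at_def)
    then have "play \<Gamma> \<sigma> (Suc k) = None" by simp
    then show False using inf by blast
  qed
next
  assume no: "\<nexists>w. terminates_at \<Gamma> \<sigma> w"
  show "\<forall>k. play \<Gamma> \<sigma> k \<noteq> None"
  proof
    fix k show "play \<Gamma> \<sigma> k \<noteq> None"
      by (induction k) (use no in \<open>auto simp: terminates_at_def\<close>)
  qed
qed

definition effective_cost :: "'v terminal_game \<Rightarrow> nat \<Rightarrow> (nat \<Rightarrow> 'v \<Rightarrow> 'v) \<Rightarrow> real" where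
  "effective_cost \<Gamma> i \<sigma> =
     (if \<exists>w. terminates_at \<Gamma> \<sigma> w then cost \<Gamma> i (THE w. terminates_at \<Gamma> \<sigma> w) else 0)"

definition nash_equilibrium :: "'v terminal_game \<Rightarrow> (nat \<Rightarrow> 'v \<Rightarrow> 'v) \<Rightarrow> bool" where
  "nash_equilibrium \<Gamma> \<sigma> \<longleftrightarrow> \<sigma> \<in> situations \<Gamma> \<and>
     (\<forall>i\<in>players \<Gamma>. \<forall>\<sigma>'\<in>situations \<Gamma>.
        (\<forall>j\<in>players \<Gamma> - {i}. \<sigma>' j = \<sigma> j) \<longrightarrow> effective_cost \<Gamma> i \<sigma> \<le> effective_cost \<Gamma> i \<sigma>')"

definition uniform_nash_equilibrium :: "'v terminal_game \<Rightarrow> (nat \<Rightarrow> 'v \<Rightarrow> 'v) \<Rightarrow> bool" where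
  "uniform_nash_equilibrium \<Gamma> \<sigma> \<longleftrightarrow>
     (\<forall>v \<in> positions \<Gamma> - terminals \<Gamma>. nash_equilibrium (\<Gamma>\<lparr>initial := v\<rparr>) \<sigma>)"

definition symmetric_game :: "'v terminal_game \<Rightarrow> bool" where
  "symmetric_game \<Gamma> \<longleftrightarrow>
     (\<forall>u v. (v, u) \<in> moves \<Gamma> \<longrightarrow> u \<notin> terminals \<Gamma> \<longrightarrow> (u, v) \<in> moves \<Gamma>)"

end

theory Submission imports Defs begin

text \<open>Break ties so that each player ranks the terminals strictly, with infinite play last. A situation
is a uniform equilibrium as soon as no single move is improving, i.e. leads its owner to a position
with a better outcome. Consider partial strategies, where reaching an unassigned position counts as
infinite play. Start with player 2 playing optimally without ever entering player 1's positions,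
and player 1 responding optimally; then only moves of player 2 into positions of player 1 can be
improving. Among these choose the one whose outcome \<open>z\<close> is best for player 2, and redirect. The graph
being symmetric, player 1 has a move back and does not gain by it, so both players weakly gain, at
this position and wherever the play passes through it. This can make moves to other positions
with outcome \<open>z\<close> improving, but by the choice of \<open>z\<close> these again make neither player worse off.
Once they are exhausted, choose the next \<open>z\<close>. The payoffs only increase, so the process stops.\<close>

section \<open>Outcomes of partial strategies\<close>

text \<open>Least fixed point: infinite walks and walks stuck at an unassigned position both have no
  derivation, so the two failures coincide from the start.\<close>

inductive ends_at :: "'v set \<Rightarrow> ('v \<Rightarrow> 'v option) \<Rightarrow> 'v \<Rightarrow> 'v \<Rightarrow> bool" for T s where
  terminal: "w \<in> T \<Longrightarrow> ends_at T s w w"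
| move: "v \<notin> T \<Longrightarrow> s v = Some u \<Longrightarrow> ends_at T s u w \<Longrightarrow> ends_at T s v w"

lemma ends_at_in: "ends_at T s v w \<Longrightarrow> w \<in> T"
  by (induction rule: ends_at.induct) auto

lemma ends_at_terminal_iff: "v \<in> T \<Longrightarrow> ends_at T s v w \<longleftrightarrow> w = v"
  by (auto elim: ends_at.cases intro: ends_at.intros)

lemma ends_at_move_iff: "v \<notin> T \<Longrightarrow> ends_at T s v w \<longleftrightarrow> (\<exists>u. s v = Some u \<and> ends_at T s u w)"
  by (auto elim: ends_at.cases intro: ends_at.intros)

lemma ends_at_unique: "ends_at T s v w \<Longrightarrow> ends_at T s v w' \<Longrightarrow> w = w'"
  by (induction rule: ends_at.induct) (auto simp: ends_at_terminal_iff ends_at_move_iff)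

definition outcome :: "'v set \<Rightarrow> ('v \<Rightarrow> 'v option) \<Rightarrow> 'v \<Rightarrow> 'v option" where
  "outcome T s v = (if \<exists>w. ends_at T s v w then Some (THE w. ends_at T s v w) else None)"

lemma outcome_eq_Some_iff: "outcome T s v = Some w \<longleftrightarrow> ends_at T s v w"
proof -
  have "(THE w. ends_at T s v w) = w'" if "ends_at T s v w'" for w'
    using that ends_at_unique by (metis the_equality)
  then show ?thesis unfolding outcome_def by auto
qed

lemma outcome_eqI: "(\<And>w. ends_at T s v w \<longleftrightarrow> ends_at T s' v' w) \<Longrightarrow> outcome T s v = outcome T s' v'"
  unfolding outcome_def by presburger

lemma outcome_terminal: "w \<in> T \<Longrightarrow> outcome T s w = Some w"
  by (simp add: outcome_eq_Some_iff ends_at.terminal)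

lemma outcome_move: "v \<notin> T \<Longrightarrow> s v = Some u \<Longrightarrow> outcome T s v = outcome T s u"
  by (rule outcome_eqI) (simp add: ends_at_move_iff)

lemma outcome_unassigned: "v \<notin> T \<Longrightarrow> s v = None \<Longrightarrow> outcome T s v = None"
  by (auto simp: outcome_def ends_at_move_iff)

lemma outcome_range: "outcome T s v \<in> insert None (Some ` T)"
  by (cases "outcome T s v") (auto simp: outcome_eq_Some_iff dest: ends_at_in)

section \<open>Effect of redirecting one position\<close>

context
  fixes T :: "'v set" and s :: "'v \<Rightarrow> 'v option" and v u w :: 'v
  assumes v: "v \<notin> T" and u: "outcome T s u = Some w"
    and neq: "outcome T s v \<noteq> Some w"
begin

text \<open>A play through \<open>v\<close> would share its end with \<open>v\<close>; a play that
  ends elsewhere therefore avoids \<open>v\<close> and does not see the update.\<close>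

lemma ends_at_upd_other:
  "ends_at T s x y \<Longrightarrow> \<not> ends_at T s v y \<Longrightarrow> ends_at T (s(v \<mapsto> u)) x y"
proof (induction rule: ends_at.induct)
  case (move x x' y)
  then have "x \<noteq> v" by (blast intro: ends_at.move)
  with move show ?case by (auto intro: ends_at.move)
qed (rule ends_at.terminal)

text \<open>Because \<open>v\<close> did not lead to \<open>w\<close>, the play from
  \<open>u\<close> avoids \<open>v\<close>. So the redirection closes no cycle.\<close>

lemma ends_at_upd_target: "ends_at T (s(v \<mapsto> u)) u w"
  using u neq by (intro ends_at_upd_other) (auto simp: outcome_eq_Some_iff)

lemma ends_at_upd_self: "ends_at T (s(v \<mapsto> u)) v w"
  using v ends_at_upd_target by (auto intro: ends_at.move)

lemma outcome_upd_self: "outcome T (s(v \<mapsto> u)) v = Some w"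
  by (simp add: outcome_eq_Some_iff ends_at_upd_self)

lemma ends_at_upd_same:
  "ends_at T s x y \<Longrightarrow> ends_at T (s(v \<mapsto> u)) x y \<or> ends_at T (s(v \<mapsto> u)) x w"
proof (induction rule: ends_at.induct)
  case (move x x' y)
  show ?case
  proof (cases "x = v")
    case True
    then show ?thesis using ends_at_upd_self by blast
  next
    case False
    then show ?thesis using move by (auto intro: ends_at.move)
  qed
qed (simp add: ends_at.terminal)

lemma ends_at_updD:
  "ends_at T (s(v \<mapsto> u)) x y \<Longrightarrow> ends_at T s x y \<or> y = w"
proof (induction rule: ends_at.induct)
  case (move x x' y)
  show ?case
  proof (cases "x = v")
    case True
    then have "ends_at T (s(v \<mapsto> u)) u y"
      using move.hyps(2,3) by (metis fun_upd_same option.inject)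
    then show ?thesis using ends_at_unique[OF _ ends_at_upd_target] by blast
  next
    case False
    then show ?thesis using move by (auto intro: ends_at.move)
  qed
qed (simp add: ends_at.terminal)

text \<open>Only plays through \<open>v\<close> can change. The alternative \<open>None\<close> is
  cruder than necessary, but harmless later, since \<open>None\<close> has payoff 0.\<close>

lemma outcome_upd:
  "outcome T (s(v \<mapsto> u)) x = outcome T s x \<or>
   outcome T (s(v \<mapsto> u)) x = Some w \<and> outcome T s x \<in> {outcome T s v, None}"
proof (cases "outcome T s x")
  case None
  then show ?thesis
    using ends_at_updD[of x] by (metis insertCI not_Some_eq outcome_eq_Some_iff)
next
  case (Some y)
  then show ?thesis
    using ends_at_upd_same[of x y] ends_at_upd_other[of x y]
    by (metis insertCI outcome_eq_Some_iff)
qed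

end

section \<open>Optimal responses by maximizing a potential\<close>

lemma bounded_has_greatest_nat:
  fixes f :: "'a \<Rightarrow> nat"
  assumes "P k" and "\<And>y. P y \<Longrightarrow> f y \<le> b"
  shows "\<exists>x. P x \<and> (\<forall>y. P y \<longrightarrow> f y \<le> f x)"
  using assms ex_has_greatest_nat[of P k f "Suc b"] by (simp add: less_Suc_eq_le)

text \<open>Maximize the sum of the payoffs over \<open>X\<close>: taking an improving move raises
  it at \<open>v\<close> and lowers it nowhere, by \<open>outcome_upd\<close>. Positions of
  \<open>X\<close> may stay unassigned, so \<open>E\<close> need not offer a move
  everywhere.\<close>

lemma optimal_response:
  fixes P :: "'v option \<Rightarrow> nat"
  assumes fin: "finite X" and XT: "X \<inter> T = {}" and s0: "\<And>v. v \<in> X \<Longrightarrow> s0 v = None"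
    and P0: "P None = 0" and bound: "\<And>y. y \<in> insert None (Some ` T) \<Longrightarrow> P y \<le> N"
  shows "\<exists>s. (\<forall>v. v \<notin> X \<longrightarrow> s v = s0 v) \<and> (\<forall>v\<in>X. \<forall>u. s v = Some u \<longrightarrow> (v, u) \<in> E) \<and>
     (\<forall>(v, u)\<in>E. v \<in> X \<longrightarrow> P (outcome T s u) \<le> P (outcome T s v))"
proof -
  define A where
    "A s \<longleftrightarrow> (\<forall>v. v \<notin> X \<longrightarrow> s v = s0 v) \<and> (\<forall>v\<in>X. \<forall>u. s v = Some u \<longrightarrow> (v, u) \<in> E)" for s
  define pot where "pot s = (\<Sum>v\<in>X. P (outcome T s v))" for s
  have "A s0" using s0 by (auto simp: A_def)
  moreover have "pot s \<le> card X * N" for s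
    unfolding pot_def using sum_bounded_above[of X "\<lambda>v. P (outcome T s v)" N]
      bound[OF outcome_range] by auto
  ultimately obtain s where s: "A s" and max: "\<And>s'. A s' \<Longrightarrow> pot s' \<le> pot s"
    using bounded_has_greatest_nat[of A s0 pot] by metis
  have "P (outcome T s u) \<le> P (outcome T s v)" if E: "(v, u) \<in> E" and v: "v \<in> X" for v u
  proof (rule ccontr)
    assume "\<not> ?thesis"
    then have lt: "P (outcome T s v) < P (outcome T s u)" by simp
    then obtain w where w: "outcome T s u = Some w" using P0 by (cases "outcome T s u") auto
    have vT: "v \<notin> T" and neq: "outcome T s v \<noteq> Some w" using v XT lt w by auto
    note upd = outcome_upd_self[OF vT w neq] outcome_upd[OF vT w neq]
    have "A (s(v \<mapsto> u))" using s E v by (auto simp: A_def)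
    moreover have "pot s < pot (s(v \<mapsto> u))"
      unfolding pot_def
    proof (rule sum_strict_mono_ex1[OF fin])
      show "\<forall>x\<in>X. P (outcome T s x) \<le> P (outcome T (s(v \<mapsto> u)) x)"
        using upd(2) lt w P0 by (metis empty_iff insertE le_eq_less_or_eq zero_le)
      show "\<exists>x\<in>X. P (outcome T s x) < P (outcome T (s(v \<mapsto> u)) x)"
        using upd(1) lt w v by (intro bexI[of _ v]) simp_all
    qed
    ultimately show False using max by fastforce
  qed
  then show ?thesis using s unfolding A_def by blast
qed

lemma outcome_eq_if_invariant:
  assumes "x \<in> X \<union> T"
    and inv: "\<And>v u. v \<in> X \<Longrightarrow> v \<notin> T \<Longrightarrow> s v = Some u \<Longrightarrow> u \<in> X \<union> T"
    and eq: "\<And>v. v \<in> X \<Longrightarrow> v \<notin> T \<Longrightarrow> s' v = s v"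
  shows "outcome T s' x = outcome T s x"
proof -
  have "ends_at T s x w \<Longrightarrow> x \<in> X \<union> T \<Longrightarrow> ends_at T s' x w" for w
    by (induction rule: ends_at.induct) (use inv eq in \<open>auto simp: ends_at_terminal_iff ends_at_move_iff\<close>)
  moreover have "ends_at T s' x w \<Longrightarrow> x \<in> X \<union> T \<Longrightarrow> ends_at T s x w" for w
    by (induction rule: ends_at.induct) (use inv eq in \<open>auto simp: ends_at_terminal_iff ends_at_move_iff\<close>)
  ultimately show ?thesis using assms(1) by (intro outcome_eqI) blast
qed

section \<open>Strict payoffs on a symmetric graph\<close>

text \<open>Payoffs are ranks, larger being better. Injectivity expresses the absence of ties, and
  natural numbers with a finite \<open>T\<close> make total payoffs bounded.\<close>

locale strict_game =
  fixes V1 V2 T :: "'v set" and E :: "('v \<times> 'v) set" and P1 P2 :: "'v option \<Rightarrow> nat"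
  assumes fin: "finite V1" "finite V2" "finite T"
    and disj: "V1 \<inter> V2 = {}" "V1 \<inter> T = {}" "V2 \<inter> T = {}"
    and E: "E \<subseteq> (V1 \<union> V2) \<times> (V1 \<union> V2 \<union> T)"
    and sym: "\<And>u v. (v, u) \<in> E \<Longrightarrow> u \<notin> T \<Longrightarrow> (u, v) \<in> E"
    and inj: "inj_on P1 (insert None (Some ` T))" "inj_on P2 (insert None (Some ` T))"
    and P_None: "P1 None = 0" "P2 None = 0"
begin

abbreviation f :: "('v \<Rightarrow> 'v option) \<Rightarrow> 'v \<Rightarrow> 'v option" where "f \<equiv> outcome T"

definition stable :: "('v \<Rightarrow> 'v option) \<Rightarrow> bool" where
  "stable s \<longleftrightarrow> (\<forall>v u. (v, u) \<in> E \<longrightarrow>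
     (v \<in> V1 \<longrightarrow> P1 (f s u) \<le> P1 (f s v)) \<and> (v \<in> V2 \<longrightarrow> P2 (f s u) \<le> P2 (f s v)))"

definition admissible :: "('v \<Rightarrow> 'v option) \<Rightarrow> bool" where
  "admissible s \<longleftrightarrow> (\<forall>v u. s v = Some u \<longrightarrow> (v, u) \<in> E)"

text \<open>Improving moves lead to outcome \<open>z\<close> at no loss for the opponent, except for those of player 2
  into positions of player 1. The bound \<open>P2 z\<close> on the latter ensures, by symmetry of the graph, that
  player 1 never hurts player 2 by moving from a position adjacent to player 2 to outcome \<open>z\<close>.\<close>

definition improving_towards :: "('v \<Rightarrow> 'v option) \<Rightarrow> 'v option \<Rightarrow> bool" where
  "improving_towards s z \<longleftrightarrow> (\<forall>v u. (v, u) \<in> E \<longrightarrow>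
     (v \<in> V1 \<longrightarrow> P1 (f s v) < P1 (f s u) \<longrightarrow> f s u = z \<and> P2 (f s v) \<le> P2 z) \<and>
     (v \<in> V2 \<longrightarrow> P2 (f s v) < P2 (f s u) \<longrightarrow>
        f s u = z \<and> P1 (f s v) \<le> P1 z \<or> u \<in> V1 \<and> P2 (f s u) \<le> P2 z))"

definition total_payoff :: "('v \<Rightarrow> 'v option) \<Rightarrow> nat" where
  "total_payoff s = (\<Sum>v\<in>V1 \<union> V2. P1 (f s v) + P2 (f s v))"

lemma f_inj:
  "P1 (f s v) = P1 (f s' v') \<Longrightarrow> f s v = f s' v'" "P2 (f s v) = P2 (f s' v') \<Longrightarrow> f s v = f s' v'"
  using inj outcome_range[of T] by (meson inj_onD)+

lemma payoff_bounded: "\<exists>N. \<forall>y\<in>insert None (Some ` T). P1 y + P2 y \<le> N"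
proof (intro exI ballI)
  fix y assume "y \<in> insert None (Some ` T)"
  then show "P1 y + P2 y \<le> Max ((\<lambda>y. P1 y + P2 y) ` insert None (Some ` T))"
    using fin by (intro Max_ge) auto
qed

text \<open>A move can become improving only if its target \<open>u\<close> changed, hence now has
  outcome \<open>z\<close>. Its source \<open>v\<close> then did not change, and it remains to bound
  a payoff at \<open>v\<close> by that of \<open>z\<close>. This is done by comparing
  \<open>v\<close> with the old outcome of \<open>u\<close>, which was no better than
  \<open>z\<close> for either player.\<close>

lemma improving_towards_mono:
  assumes inv: "improving_towards s z"
    and s': "\<And>x. f s' x = f s x \<or> f s' x = z \<and> P1 (f s x) \<le> P1 z \<and> P2 (f s x) \<le> P2 z"
  shows "improving_towards s' z"
proof -
  have mono: "P1 (f s x) \<le> P1 (f s' x)" "P2 (f s x) \<le> P2 (f s' x)" for x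
    using s'[of x] by auto
  have i1: "f s u = z \<and> P2 (f s v) \<le> P2 z"
    if "(v, u) \<in> E" "v \<in> V1" "P1 (f s v) < P1 (f s u)" for v u
    using inv that unfolding improving_towards_def by blast
  have i2: "f s u = z \<and> P1 (f s v) \<le> P1 z \<or> u \<in> V1 \<and> P2 (f s u) \<le> P2 z"
    if "(v, u) \<in> E" "v \<in> V2" "P2 (f s v) < P2 (f s u)" for v u
    using inv that unfolding improving_towards_def by blast
  have owner: "u \<in> V1 \<or> u \<in> V2" if "f s' u \<noteq> f s u" "(v, u) \<in> E" for v u
    using that E outcome_terminal[of u T] by fastforce
  \<comment> \<open>Terminals keep their outcome, so a changed \<open>u\<close> is not terminal and
    the move can be reversed.\<close>
  have rev: "(u, v) \<in> E" if "f s' u \<noteq> f s u" "(v, u) \<in> E" for v u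
    using that sym outcome_terminal[of u T] by metis
  have "f s' u = z \<and> P2 (f s' v) \<le> P2 z"
    if e: "(v, u) \<in> E" "v \<in> V1" and lt: "P1 (f s' v) < P1 (f s' u)" for v u
  proof (cases "f s' u = f s u")
    case True
    then have "f s u = z \<and> P2 (f s v) \<le> P2 z"
      using i1[OF e] lt mono(1)[of v] by simp
    then show ?thesis using True s'[of v] by auto
  next
    case False
    then have u: "f s' u = z" "P1 (f s u) \<le> P1 z" "P2 (f s u) \<le> P2 z" using s'[of u] by auto
    have v: "f s' v = f s v" using s'[of v] lt u by auto
    have "P2 (f s v) \<le> P2 z"
    proof (cases "P1 (f s v)" "P1 (f s u)" rule: linorder_cases)
      case less
      then show ?thesis using i1[OF e] by simp
    next
      case equal
      then have "f s v = f s u" by (rule f_inj)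
      then show ?thesis using u by simp
    next
      case greater
      \<comment> \<open>The mover prefers the outcome of \<open>v\<close> to the old one of
        \<open>u\<close>, so the invariant is applied to the reverse move. If player 2 owns
        \<open>u\<close> and would gain by it, this is a move into \<open>V1\<close>, where the
        bound by \<open>P2 z\<close> takes effect.\<close>
      show ?thesis
        using owner[OF False e(1)]
      proof
        assume "u \<in> V1"
        then show ?thesis using i1[OF rev[OF False e(1)]] greater by simp
      next
        assume "u \<in> V2"
        then show ?thesis
          using i2[OF rev[OF False e(1)]] u by (cases "P2 (f s u) < P2 (f s v)") auto
      qed
    qed
    then show ?thesis using u v by simp
  qed
  moreover have "f s' u = z \<and> P1 (f s' v) \<le> P1 z \<or> u \<in> V1 \<and> P2 (f s' u) \<le> P2 z"
    if e: "(v, u) \<in> E" "v \<in> V2" and lt: "P2 (f s' v) < P2 (f s' u)" for v u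
  proof (cases "f s' u = f s u")
    case True
    then have "f s u = z \<and> P1 (f s v) \<le> P1 z \<or> u \<in> V1 \<and> P2 (f s u) \<le> P2 z"
      using i2[OF e] lt mono(2)[of v] by simp
    then show ?thesis using True s'[of v] by auto
  next
    case False
    then have u: "f s' u = z" "P1 (f s u) \<le> P1 z" "P2 (f s u) \<le> P2 z" using s'[of u] by auto
    have v: "f s' v = f s v" using s'[of v] lt u by auto
    show ?thesis
      using owner[OF False e(1)]
    proof
      assume "u \<in> V1"
      \<comment> \<open>New improving moves into \<open>V1\<close> are tolerated: their outcome is
        \<open>z\<close> itself, so the bound holds with equality.\<close>
      then show ?thesis using u by simp
    next
      assume uV: "u \<in> V2"
      have "P1 (f s v) \<le> P1 z"
      proof (cases "P2 (f s v)" "P2 (f s u)" rule: linorder_cases)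
        case less
        then show ?thesis using i2[OF e] uV disj by auto
      next
        case equal
        then have "f s v = f s u" by (rule f_inj)
        then show ?thesis using u by simp
      next
        case greater
        \<comment> \<open>The reverse move improves for player 2 and stays in \<open>V2\<close>,
          which excludes the second alternative of the invariant.\<close>
        then have "f s v = z"
          using i2[OF rev[OF False e(1)] uV] e(2) disj by auto
        then show ?thesis by simp
      qed
      then show ?thesis using u v by simp
    qed
  qed
  ultimately show ?thesis unfolding improving_towards_def by blast
qed

text \<open>Each changed outcome was that of \<open>v\<close> or \<open>None\<close>, so nobody
  loses anywhere and \<open>improving_towards_mono\<close> applies. At \<open>v\<close> the outcome
  really changes, so by strictness the weak gain of player 1 is a proper one.\<close>

lemma redirect:
  assumes inv: "improving_towards s z" and adm: "admissible s"
    and e: "(v, u) \<in> E" and z: "f s u = z" "f s v \<noteq> z"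
    and le: "P1 (f s v) \<le> P1 z" "P2 (f s v) \<le> P2 z"
  shows "\<exists>s'. admissible s' \<and> improving_towards s' z \<and> total_payoff s < total_payoff s'"
proof (intro exI conjI)
  let ?s = "s(v \<mapsto> u)"
  have vV: "v \<in> V1 \<union> V2" and vT: "v \<notin> T" using e E disj by auto
  \<comment> \<open>An outcome \<open>None\<close> has the least payoff, so \<open>v\<close> could
    weakly gain from it only by having it already.\<close>
  have "z \<noteq> None"
  proof
    assume "z = None"
    then have "P1 (f s v) = P1 (f s u)" using le P_None z by simp
    then show False using f_inj z by blast
  qed
  then obtain w where w: "z = Some w" by auto
  note upd = outcome_upd_self[OF vT z(1)[unfolded w] z(2)[unfolded w], folded w]
    outcome_upd[OF vT z(1)[unfolded w] z(2)[unfolded w], folded w]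
  have s': "f ?s x = f s x \<or> f ?s x = z \<and> P1 (f s x) \<le> P1 z \<and> P2 (f s x) \<le> P2 z" for x
    using upd(2)[of x] le P_None by auto
  show "admissible ?s" using adm e by (auto simp: admissible_def)
  show "improving_towards ?s z" by (rule improving_towards_mono[OF inv s'])
  show "total_payoff s < total_payoff ?s"
    unfolding total_payoff_def
  proof (rule sum_strict_mono_ex1)
    show "\<forall>x\<in>V1 \<union> V2. P1 (f s x) + P2 (f s x) \<le> P1 (f ?s x) + P2 (f ?s x)"
      using s' by (metis add_mono order_refl)
    have "P1 (f s v) \<noteq> P1 z" using f_inj(1) z by blast
    then show "\<exists>x\<in>V1 \<union> V2. P1 (f s x) + P2 (f s x) < P1 (f ?s x) + P2 (f ?s x)"
      using upd(1) vV le by (intro bexI[of _ v]) auto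
  qed (use fin in auto)
qed

text \<open>Either some move to \<open>z\<close> is still weakly good for both players and is taken,
  or \<open>z\<close> is exhausted and a new target is chosen.\<close>

lemma progress:
  assumes inv: "improving_towards s z" and adm: "admissible s" and ns: "\<not> stable s"
  shows "\<exists>s' z'. admissible s' \<and> improving_towards s' z' \<and> total_payoff s < total_payoff s'"
proof (cases "\<exists>v u. (v, u) \<in> E \<and> f s u = z \<and> f s v \<noteq> z \<and> P1 (f s v) \<le> P1 z \<and> P2 (f s v) \<le> P2 z")
  case True
  then show ?thesis using redirect[OF inv adm] by blast
next
  case False
  have no1: "P1 (f s u) \<le> P1 (f s v)" if "(v, u) \<in> E" "v \<in> V1" for v u
  proof (rule ccontr)
    assume "\<not> ?thesis"
    then have lt: "P1 (f s v) < P1 (f s u)" by simp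
    then have "f s u = z" "P2 (f s v) \<le> P2 z"
      using inv that unfolding improving_towards_def by blast+
    then show False using False that lt by (metis less_imp_le less_irrefl)
  qed
  have to1: "u \<in> V1" if "(v, u) \<in> E" "v \<in> V2" "P2 (f s v) < P2 (f s u)" for v u
  proof (rule ccontr)
    assume "u \<notin> V1"
    then have "f s u = z \<and> P1 (f s v) \<le> P1 z"
      using inv that unfolding improving_towards_def by blast
    then show False using False that by (metis less_imp_le less_irrefl)
  qed
  \<comment> \<open>Only improving moves of player 2 into \<open>V1\<close> remain; the one whose
    outcome is best for player 2 supplies the new target.\<close>
  define W where "W e \<longleftrightarrow> e \<in> E \<and> fst e \<in> V2 \<and> P2 (f s (fst e)) < P2 (f s (snd e))" for e
  obtain N where N: "\<forall>y\<in>insert None (Some ` T). P1 y + P2 y \<le> N" using payoff_bounded by blast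
  have "\<exists>e. W e" using ns no1 unfolding stable_def W_def by (metis fst_conv snd_conv linorder_not_le)
  then obtain e where "W e" ..
  moreover have "P2 (f s (snd e)) \<le> N" for e
    using N outcome_range[of T s] by (metis add_leD2)
  ultimately have "\<exists>e. W e \<and> (\<forall>e'. W e' \<longrightarrow> P2 (f s (snd e')) \<le> P2 (f s (snd e)))"
    by (intro bounded_has_greatest_nat)
  then obtain e where e: "W e" and max: "\<And>e'. W e' \<Longrightarrow> P2 (f s (snd e')) \<le> P2 (f s (snd e))"
    by metis
  obtain v u where vu: "e = (v, u)" by (cases e)
  have vuE: "(v, u) \<in> E" "v \<in> V2" "P2 (f s v) < P2 (f s u)" using e vu by (auto simp: W_def)
  have u: "u \<in> V1" by (rule to1[OF vuE])
  \<comment> \<open>By symmetry player 1 can move from \<open>u\<close> back to \<open>v\<close>,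
    and by \<open>no1\<close> does not gain from it.\<close>
  have "P1 (f s v) \<le> P1 (f s u)"
    using no1[OF sym[OF vuE(1)] u] u disj by auto
  \<comment> \<open>Maximality is exactly the bound on the moves into \<open>V1\<close>; by
    \<open>to1\<close> there are no other improving moves.\<close>
  moreover have "improving_towards s (f s u)"
    unfolding improving_towards_def
  proof (intro allI impI conjI)
    fix v' u' assume e': "(v', u') \<in> E" "v' \<in> V2" "P2 (f s v') < P2 (f s u')"
    then have "u' \<in> V1 \<and> P2 (f s u') \<le> P2 (f s u)"
      using to1 max[of "(v', u')"] vu by (auto simp: W_def)
    then show "f s u' = f s u \<and> P1 (f s v') \<le> P1 (f s u) \<or> u' \<in> V1 \<and> P2 (f s u') \<le> P2 (f s u)" ..
  qed (use no1 in \<open>auto simp: not_less[symmetric]\<close>)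
  ultimately show ?thesis
    using redirect[OF _ adm vuE(1) refl] vuE(3) by fastforce
qed

lemma initial_state: "\<exists>s z. admissible s \<and> improving_towards s z"
proof -
  obtain N where N: "\<forall>y\<in>insert None (Some ` T). P1 y + P2 y \<le> N" using payoff_bounded by blast
  have N12: "P1 y \<le> N" "P2 y \<le> N" if "y \<in> insert None (Some ` T)" for y
    using N that by (metis add_leD1, metis add_leD2)
  \<comment> \<open>Player 2 first optimizes without the moves into \<open>V1\<close>. A position
    with no other move stays unassigned.\<close>
  define E2 where "E2 = {(v, u) \<in> E. u \<notin> V1}"
  obtain s2 where s2: "\<forall>v. v \<notin> V2 \<longrightarrow> s2 v = None" "\<forall>v\<in>V2. \<forall>u. s2 v = Some u \<longrightarrow> (v, u) \<in> E2"
      "\<forall>(v, u)\<in>E2. v \<in> V2 \<longrightarrow> P2 (f s2 u) \<le> P2 (f s2 v)"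
    using optimal_response[of V2 T "\<lambda>_. None" P2 N E2] fin disj P_None N12(2) by blast
  obtain s where s: "\<forall>v. v \<notin> V1 \<longrightarrow> s v = s2 v" "\<forall>v\<in>V1. \<forall>u. s v = Some u \<longrightarrow> (v, u) \<in> E"
      "\<forall>(v, u)\<in>E. v \<in> V1 \<longrightarrow> P1 (f s u) \<le> P1 (f s v)"
    using optimal_response[of V1 T s2 P1 N E] fin disj P_None N12(1) s2(1) by blast
  \<comment> \<open>Player 2's moves never leave \<open>V2\<close> except to terminals, so player
    1's response cannot affect these outcomes.\<close>
  have same: "f s x = f s2 x" if "x \<in> V2 \<union> T" for x
  proof (rule outcome_eq_if_invariant[OF that])
    show "s2 v = Some u \<Longrightarrow> u \<in> V2 \<union> T" if "v \<in> V2" for v u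
      using s2(2) that E by (auto simp: E2_def)
    show "s v = s2 v" if "v \<in> V2" for v using s(1) that disj by auto
  qed
  have V2: "P2 (f s u) \<le> P2 (f s v)" if "(v, u) \<in> E" "v \<in> V2" "u \<notin> V1" for v u
  proof -
    have "(v, u) \<in> E2" "u \<in> V2 \<union> T" using that E by (auto simp: E2_def)
    then show ?thesis using s2(3) that same by auto
  qed
  have "admissible s"
    unfolding admissible_def
  proof (intro allI impI)
    fix v u assume "s v = Some u"
    then show "(v, u) \<in> E"
      using s(1,2) s2(1,2) by (cases "v \<in> V1"; cases "v \<in> V2") (auto simp: E2_def)
  qed
  \<comment> \<open>With player 2's favourite outcome as first target, the bound on moves into
    \<open>V1\<close> holds trivially.\<close>
  moreover have "\<exists>w. w \<in> insert None (Some ` T) \<and> (\<forall>y. y \<in> insert None (Some ` T) \<longrightarrow> P2 y \<le> P2 w)"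
    by (rule bounded_has_greatest_nat[OF _ N12(2)]) auto
  then obtain w where "\<And>y. y \<in> insert None (Some ` T) \<Longrightarrow> P2 y \<le> P2 w" by metis
  then have w: "P2 (f s u) \<le> P2 w" for u using outcome_range by metis
  have "improving_towards s w"
    unfolding improving_towards_def
  proof (intro allI impI conjI)
    fix v u assume e: "(v, u) \<in> E" "v \<in> V2" "P2 (f s v) < P2 (f s u)"
    then have "u \<in> V1" using V2[OF e(1,2)] by auto
    then show "f s u = w \<and> P1 (f s v) \<le> P1 w \<or> u \<in> V1 \<and> P2 (f s u) \<le> P2 w" using w by simp
  qed (use s(3) in fastforce)+
  ultimately show ?thesis by blast
qed

theorem stable_exists: "\<exists>s. admissible s \<and> stable s"
proof -
  define A where "A s \<longleftrightarrow> admissible s \<and> (\<exists>z. improving_towards s z)" for s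
  obtain N where N: "\<forall>y\<in>insert None (Some ` T). P1 y + P2 y \<le> N" using payoff_bounded by blast
  obtain s0 where "A s0" using initial_state unfolding A_def by blast
  moreover have "total_payoff s \<le> card (V1 \<union> V2) * N" for s
    unfolding total_payoff_def
    using sum_bounded_above[of "V1 \<union> V2" "\<lambda>v. P1 (f s v) + P2 (f s v)" N]
      bspec[OF N outcome_range] by simp
  ultimately have "\<exists>s. A s \<and> (\<forall>s'. A s' \<longrightarrow> total_payoff s' \<le> total_payoff s)"
    by (intro bounded_has_greatest_nat)
  then obtain s where "A s" and max: "\<And>s'. A s' \<Longrightarrow> total_payoff s' \<le> total_payoff s"
    by metis
  then show ?thesis using progress unfolding A_def by (metis linorder_not_le)
qed

end

section \<open>Breaking ties between terminals\<close>

lemma strict_payoff_exists: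
  fixes c :: "'v \<Rightarrow> real"
  assumes fin: "finite T"
  shows "\<exists>P :: 'v option \<Rightarrow> nat. P None = 0 \<and> inj_on P (insert None (Some ` T)) \<and>
    (\<forall>w\<in>T. \<forall>w'\<in>T. c w' < c w \<longrightarrow> P (Some w) < P (Some w'))"
proof -
  obtain g :: "'v \<Rightarrow> nat" where g: "inj_on g T" using finite_imp_inj_to_nat_seg[OF fin] by blast
  \<comment> \<open>The rank of \<open>w\<close> counts the terminals that are no better, with ties
    broken by \<open>g\<close>. As \<open>w\<close> counts itself, every rank exceeds the 0 of
    \<open>None\<close>.\<close>
  define B where "B w = {w' \<in> T. c w < c w' \<or> c w = c w' \<and> g w' \<le> g w}" for w
  define P where "P y = (case y of None \<Rightarrow> 0 | Some w \<Rightarrow> card (B w))" for y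
  have lt: "card (B w) < card (B w')"
    if "w \<in> T" "w' \<in> T" "c w' < c w \<or> c w' = c w \<and> g w < g w'" for w w'
  proof (rule psubset_card_mono)
    show "finite (B w')" using fin by (simp add: B_def)
    have "w' \<in> B w'" "w' \<notin> B w" "B w \<subseteq> B w'" using that by (auto simp: B_def)
    then show "B w \<subset> B w'" by blast
  qed
  have pos: "card (B w) \<noteq> 0" if "w \<in> T" for w
    using that fin by (auto simp: card_eq_0_iff B_def)
  have neq: "w = w'" if "w \<in> T" "w' \<in> T" "card (B w) = card (B w')" for w w'
  proof (rule ccontr)
    assume "w \<noteq> w'"
    then have "g w \<noteq> g w'" using g that by (meson inj_onD)
    then show False using lt[of w w'] lt[of w' w] that by linarith
  qed
  have "inj_on P (insert None (Some ` T))"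
  proof (rule inj_onI)
    fix x y assume "x \<in> insert None (Some ` T)" "y \<in> insert None (Some ` T)" "P x = P y"
    then show "x = y" using neq pos by (cases x; cases y) (auto simp: P_def dest: pos)
  qed
  then show ?thesis using lt by (intro exI[of _ P]) (auto simp: P_def)
qed

section \<open>From stable partial strategies to uniform equilibria\<close>

lemma owner_initial [simp]: "owner (\<Gamma>\<lparr>initial := v\<rparr>) = owner \<Gamma>"
  by (simp add: owner_def players_def fun_eq_iff)

text \<open>\<open>play\<close> grows at its end whereas \<open>ends_at\<close> recurses on the
  first move; shifting the initial position links the two.\<close>

lemma play_Suc_initial:
  assumes "v \<notin> terminals \<Gamma>"
  shows "play (\<Gamma>\<lparr>initial := v\<rparr>) \<sigma> (Suc k) = play (\<Gamma>\<lparr>initial := \<sigma> (owner \<Gamma> v) v\<rparr>) \<sigma> k"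
  using assms by (induction k) (auto split: option.splits)

lemma terminates_at_move:
  assumes "v \<notin> terminals \<Gamma>"
    and "terminates_at (\<Gamma>\<lparr>initial := \<sigma> (owner \<Gamma> v) v\<rparr>) \<sigma> w"
  shows "terminates_at (\<Gamma>\<lparr>initial := v\<rparr>) \<sigma> w"
proof -
  obtain k where "w \<in> terminals \<Gamma>" "play (\<Gamma>\<lparr>initial := \<sigma> (owner \<Gamma> v) v\<rparr>) \<sigma> k = Some w"
    using assms(2) by (auto simp: terminates_at_def)
  then have "play (\<Gamma>\<lparr>initial := v\<rparr>) \<sigma> (Suc k) = Some w"
    using play_Suc_initial[OF assms(1)] by simp
  then show ?thesis using \<open>w \<in> terminals \<Gamma>\<close> by (auto simp: terminates_at_def simp del: play.simps)
qed

lemma terminates_at_terminal: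
  "w \<in> terminals \<Gamma> \<Longrightarrow> terminates_at (\<Gamma>\<lparr>initial := w\<rparr>) \<sigma> w"
  by (auto simp: terminates_at_def intro: exI[of _ 0])

lemma effective_cost_eq: "terminates_at \<Gamma> \<sigma> w \<Longrightarrow> effective_cost \<Gamma> i \<sigma> = cost \<Gamma> i w"
  unfolding effective_cost_def using terminates_at_unique by (metis the_equality)

lemma owner_eq:
  assumes "is_terminal_game \<Gamma>" "i \<in> players \<Gamma>" "v \<in> control \<Gamma> i"
  shows "owner \<Gamma> v = i"
proof -
  have "j = i" if "j \<in> players \<Gamma>" "v \<in> control \<Gamma> j" for j
    using assms that unfolding is_terminal_game_def disjoint_family_on_def by blast
  then show ?thesis using assms(2,3) unfolding owner_def by blast
qed

lemma controlled_nonterminal: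
  assumes "is_terminal_game \<Gamma>" "i \<in> players \<Gamma>" "v \<in> control \<Gamma> i"
  shows "v \<in> positions \<Gamma> - terminals \<Gamma>"
proof -
  have "positions \<Gamma> = (\<Union>i\<in>players \<Gamma>. control \<Gamma> i) \<union> terminals \<Gamma>"
    and "control \<Gamma> i \<inter> terminals \<Gamma> = {}"
    using assms(1,2) unfolding is_terminal_game_def by simp_all
  then show ?thesis using assms(2,3) by auto
qed

theorem theorem3:
  fixes \<Gamma> :: "'v terminal_game"
  assumes "is_terminal_game \<Gamma>"
    and "num_players \<Gamma> = 2"
    and "symmetric_game \<Gamma>"
    and "\<forall>i\<in>players \<Gamma>. \<forall>w\<in>terminals \<Gamma>. cost \<Gamma> i w < 0"
  shows "\<exists>\<sigma>. uniform_nash_equilibrium \<Gamma> \<sigma>"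
proof -
  let ?T = "terminals \<Gamma>" and ?E = "moves \<Gamma>"
  have players: "players \<Gamma> = {1, 2}"
    using assms(2) by (auto simp: players_def)
  note game = assms(1)[unfolded is_terminal_game_def players]
  have pos: "positions \<Gamma> = control \<Gamma> 1 \<union> control \<Gamma> 2 \<union> ?T" and finV: "finite (positions \<Gamma>)"
    and EV: "?E \<subseteq> positions \<Gamma> \<times> positions \<Gamma>"
    and ter: "\<And>v. v \<in> positions \<Gamma> \<Longrightarrow> v \<in> ?T \<longleftrightarrow> ?E `` {v} = {}"
    and disj: "control \<Gamma> 1 \<inter> ?T = {}" "control \<Gamma> 2 \<inter> ?T = {}"
    using game by blast+
  have disj12: "control \<Gamma> 1 \<inter> control \<Gamma> 2 = {}"
    using game by (simp add: disjoint_family_on_def)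
  have finT: "finite ?T" using pos finV by auto
  have "\<exists>P :: 'v option \<Rightarrow> nat. P None = 0 \<and> inj_on P (insert None (Some ` ?T)) \<and>
    (\<forall>w\<in>?T. \<forall>w'\<in>?T. cost \<Gamma> i w' < cost \<Gamma> i w \<longrightarrow> P (Some w) < P (Some w'))" for i
    by (rule strict_payoff_exists[OF finT])
  then obtain P :: "nat \<Rightarrow> 'v option \<Rightarrow> nat" where P0: "\<And>i. P i None = 0"
    and Pinj: "\<And>i. inj_on (P i) (insert None (Some ` ?T))"
    and Pcost: "\<And>i w w'. w \<in> ?T \<Longrightarrow> w' \<in> ?T \<Longrightarrow> cost \<Gamma> i w' < cost \<Gamma> i w \<Longrightarrow>
      P i (Some w) < P i (Some w')"
    by metis
  have Ppos: "0 < P i (Some w)" if "w \<in> ?T" for i w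
    using P0[of i] Pinj[of i] that inj_onD[of "P i" _ "Some w" None] by fastforce
  interpret strict_game "control \<Gamma> 1" "control \<Gamma> 2" ?T ?E "P 1" "P 2"
  proof
    show "?E \<subseteq> (control \<Gamma> 1 \<union> control \<Gamma> 2) \<times> (control \<Gamma> 1 \<union> control \<Gamma> 2 \<union> ?T)"
      using EV pos ter by blast
    show "\<And>u v. (v, u) \<in> ?E \<Longrightarrow> u \<notin> ?T \<Longrightarrow> (u, v) \<in> ?E"
      using assms(3) unfolding symmetric_game_def by blast
  qed (use pos finV disj disj12 P0 Pinj in auto)
  obtain s where adm: "admissible s" and stab: "stable s" using stable_exists by blast
  have stabi: "P i (f s u) \<le> P i (f s v)" if "(v, u) \<in> ?E" "i \<in> players \<Gamma>" "v \<in> control \<Gamma> i" for i v u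
    using stab that players unfolding stable_def by auto
  \<comment> \<open>Completes \<open>s\<close> to total strategies; the choice at unassigned
    positions is arbitrary.\<close>
  define t where "t v = (case s v of Some u \<Rightarrow> u | None \<Rightarrow> SOME u. (v, u) \<in> ?E)" for v
  have tE: "(v, t v) \<in> ?E" if "v \<in> positions \<Gamma> - ?T" for v
  proof -
    have "\<exists>u. (v, u) \<in> ?E" using ter that by blast
    then show ?thesis
      using adm someI_ex[of "\<lambda>u. (v, u) \<in> ?E"]
      by (auto simp: t_def admissible_def split: option.split)
  qed
  have ft: "f s (t v) = f s v" if i: "i \<in> players \<Gamma>" "v \<in> control \<Gamma> i" for i v
  proof -
    note v = controlled_nonterminal[OF assms(1) i]
    show ?thesis
    proof (cases "s v")
      case (Some u)
      then show ?thesis using v outcome_move[of v ?T s u] by (simp add: t_def)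
    next
      case None
      then have fv: "f s v = None" using v by (simp add: outcome_unassigned)
      \<comment> \<open>At an unassigned \<open>v\<close> stability forces every move to lead to
        outcome \<open>None\<close>, so any choice keeps the outcome.\<close>
      then have "P i (f s (t v)) = 0" using stabi[OF tE[OF v] i] P0 by simp
      then have "f s (t v) = None"
        using Ppos[of _ i] outcome_range[of ?T s "t v"] by fastforce
      then show ?thesis using fv by simp
    qed
  qed
  define \<sigma> where "\<sigma> = (\<lambda>i\<in>players \<Gamma>. \<lambda>v\<in>control \<Gamma> i. t v)"
  have \<sigma>_app: "\<sigma> i v = t v" if "i \<in> players \<Gamma>" "v \<in> control \<Gamma> i" for i v
    using that by (simp add: \<sigma>_def)
  have ctl: "\<exists>i\<in>players \<Gamma>. v \<in> control \<Gamma> i" if "v \<in> positions \<Gamma> - ?T" for v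
    using that pos players by auto
  have "(v, t v) \<in> ?E" if "i \<in> players \<Gamma>" "v \<in> control \<Gamma> i" for i v
    using tE[OF controlled_nonterminal[OF assms(1) that]] .
  then have \<sigma>_sit: "\<sigma> \<in> situations \<Gamma>"
    unfolding situations_def strategies_def \<sigma>_def by (simp add: PiE_def)
  have \<sigma>_end: "terminates_at (\<Gamma>\<lparr>initial := v\<rparr>) \<sigma> w" if "ends_at ?T s v w" "v \<in> positions \<Gamma>" for v w
    using that
  proof (induction rule: ends_at.induct)
    case (terminal w)
    then show ?case by (simp add: terminates_at_terminal)
  next
    case (move v u w)
    then obtain i where i: "i \<in> players \<Gamma>" "v \<in> control \<Gamma> i" using ctl by blast
    have "\<sigma> (owner \<Gamma> v) v = u"
      using owner_eq[OF assms(1) i] \<sigma>_app[OF i] move by (simp add: t_def)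
    moreover have "u \<in> positions \<Gamma>" using adm move EV by (auto simp: admissible_def)
    ultimately show ?case using move.hyps move.IH by (simp add: terminates_at_move)
  qed
  have "nash_equilibrium (\<Gamma>\<lparr>initial := v0\<rparr>) \<sigma>" if v0: "v0 \<in> positions \<Gamma> - ?T" for v0
  proof -
    let ?G = "\<Gamma>\<lparr>initial := v0\<rparr>"
    have upd: "players ?G = players \<Gamma>" "situations ?G = situations \<Gamma>"
      by (simp_all add: players_def situations_def strategies_def)
    have "effective_cost ?G i \<sigma> \<le> effective_cost ?G i \<sigma>'"
      if i: "i \<in> players \<Gamma>" and \<sigma>': "\<sigma>' \<in> situations \<Gamma>"
        and dev: "\<forall>j\<in>players \<Gamma> - {i}. \<sigma>' j = \<sigma> j" for i \<sigma>'
    proof (cases "\<exists>w. terminates_at ?G \<sigma>' w")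
      case False
      then have "effective_cost ?G i \<sigma>' = 0" by (simp add: effective_cost_def)
      \<comment> \<open>Here terminal costs being negative is used: a deviation to an infinite play
        cannot pay off.\<close>
      moreover have "effective_cost ?G i \<sigma> \<le> 0"
      proof (cases "\<exists>w. terminates_at ?G \<sigma> w")
        case True
        then obtain w where w: "terminates_at ?G \<sigma> w" by blast
        then have "w \<in> ?T" by (simp add: terminates_at_def)
        then show ?thesis using effective_cost_eq[OF w, of i] assms(4) i by (simp add: less_imp_le)
      qed (simp add: effective_cost_def)
      ultimately show ?thesis by simp
    next
      case True
      then obtain w' where w': "terminates_at ?G \<sigma>' w'" by blast
      \<comment> \<open>Along a deviating play the rank of the current outcome under
        \<open>s\<close> never rises for player \<open>i\<close>: own moves respect stability, and
        the other player follows \<open>t\<close>, which preserves outcomes.\<close>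
      have along: "x \<in> positions \<Gamma> \<and> P i (f s x) \<le> P i (f s v0)" if "play ?G \<sigma>' k = Some x" for k x
        using that
      proof (induction k arbitrary: x)
        case 0
        then show ?case using v0 by simp
      next
        case (Suc k)
        then obtain y where y: "play ?G \<sigma>' k = Some y" "y \<notin> ?T" "x = \<sigma>' (owner \<Gamma> y) y"
          by (auto split: option.splits if_splits)
        have IH: "y \<in> positions \<Gamma>" "P i (f s y) \<le> P i (f s v0)" using Suc.IH[OF y(1)] by auto
        obtain j where j: "j \<in> players \<Gamma>" "y \<in> control \<Gamma> j" using ctl IH y by blast
        have x: "x = \<sigma>' j y" using y owner_eq[OF assms(1) j] by simp
        have "\<sigma>' j \<in> strategies \<Gamma> j" using \<sigma>' j unfolding situations_def by blast
        then have yx: "(y, x) \<in> ?E" using j x unfolding strategies_def by auto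
        have "P i (f s x) \<le> P i (f s y)"
        proof (cases "j = i")
          case True
          then show ?thesis using stabi[OF yx] j by simp
        next
          case False
          then have "x = t y" using x dev j \<sigma>_app by simp
          then show ?thesis using ft[OF j] by simp
        qed
        then show ?case using IH yx EV by auto
      qed
      have w'T: "w' \<in> ?T" using w' by (simp add: terminates_at_def)
      \<comment> \<open>At its end \<open>w'\<close> the current outcome is \<open>w'\<close>
        itself. Its rank is positive, so the outcome of \<open>v0\<close> under \<open>s\<close>
        cannot be \<open>None\<close>.\<close>
      have "P i (Some w') \<le> P i (f s v0)"
        using w' along outcome_terminal[OF w'T, of s] unfolding terminates_at_def by metis
      then obtain w where w: "f s v0 = Some w" and Pw: "P i (Some w') \<le> P i (Some w)"
        using Ppos[OF w'T, of i] P0[of i] by (cases "f s v0") auto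
      have wT: "w \<in> ?T" using w by (simp add: outcome_eq_Some_iff ends_at_in)
      have "cost \<Gamma> i w \<le> cost \<Gamma> i w'" using Pcost[OF wT w'T, of i] Pw by fastforce
      moreover have "terminates_at ?G \<sigma> w" using \<sigma>_end w v0 by (simp add: outcome_eq_Some_iff)
      ultimately show ?thesis using w' by (simp add: effective_cost_eq)
    qed
    then show ?thesis
      unfolding nash_equilibrium_def upd using \<sigma>_sit by blast
  qed
  then show ?thesis unfolding uniform_nash_equilibrium_def by blast
qed

end
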